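(* Fix any continuous, concave, strictly increasing, nonnegative function $\mathcal{G}$. Any discrete-time process $B=(B_t)_{t\ge 0}$ with $B_0=\mathcal{G}(1)$ can be uniquely (a.s.) decomposed in terms of a process $M=(M_t)_{t\ge0}$ and its running maximum $S_t=\max_{s\le t}M_s$, such that $M_0=S_0=1$ and, for all $t$, $$B_t-B_{t-1}=(M_t-M_{t-1})\,\mathcal{G}'(S_{t-1})\qquad\text{and}\qquad \max_{s\le t}B_s-B_t=(S_t-M_t)\,\mathcal{G}'(S_t).$$ The processes $M_t$ and $S_t$ are defined for any $t\ge 1$ inductively by $$M_t=1+\sum_{s=1}^{t}\frac{B_s-B_{s-1}}{\mathcal{G}'(S_{s-1})},\qquad S_t=\max_{s\le t}M_s .$$ If $B$ is a supermartingale (respectively, a martingale), then so is $M$.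
   Context: Processes are real-valued, discrete-time and adapted to a filtration $(\mathcal{F}_t)_{t\ge0}$. $\mathcal{G}$ is a real function on $[0,\infty)$, and $\mathcal{G}'$ denotes its derivative (assumed to exist wherever it is used, i.e. on $[1,\infty)$). The first displayed relation is for $t\ge1$, the second for $t\ge0$.
   Formalization: The last claim fails when M is not integrable; it is proved as: if B is a (super)martingale, M is a local one, and a true one if the negative parts of all M_t are integrable (a necessary condition); local (super)martingales B also give local ones M. *)

theory Defs
  imports "HOL-Probability.Probability"
begin

definition running_max :: "(nat \<Rightarrow> real) \<Rightarrow> nat \<Rightarrow> real" where
  "running_max x t = Max (x ` {..t})"

lemma running_max_cong [fundef_cong]:
  "s = t \<Longrightarrow> (\<And>r. r \<le> t \<Longrightarrow> x r = y r) \<Longrightarrow> running_max x s = running_max y t"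
  unfolding running_max_def by (metis atMost_iff image_cong)

text \<open>
  The path \<open>m\<close> built from a path \<open>b\<close> and the derivative \<open>g\<close>. The recursion is well-founded:
  the running maximum in the \<open>s\<close>-th summand only looks at the times up to \<open>s - 1 < t\<close>.
\<close>

function ay_path :: "(real \<Rightarrow> real) \<Rightarrow> (nat \<Rightarrow> real) \<Rightarrow> nat \<Rightarrow> real" where
  "ay_path g b t =
     1 + (\<Sum>s = 1..t. (b s - b (s - 1)) / g (running_max (\<lambda>r. ay_path g b r) (s - 1)))"
  by pat_completeness auto
termination
  by (relation "Wellfounded.measure (\<lambda>(g, b, t). t)") auto

declare ay_path.simps [simp del]

definition ay_process ::
    "(real \<Rightarrow> real) \<Rightarrow> (nat \<Rightarrow> 'a \<Rightarrow> real) \<Rightarrow> nat \<Rightarrow> 'a \<Rightarrow> real" where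
  "ay_process g B t \<omega> = ay_path g (\<lambda>s. B s \<omega>) t"

definition ay_relations :: "(real \<Rightarrow> real) \<Rightarrow> (nat \<Rightarrow> real) \<Rightarrow> (nat \<Rightarrow> real) \<Rightarrow> bool" where
  "ay_relations g b m \<longleftrightarrow>
     m 0 = 1 \<and> running_max m 0 = 1 \<and>
     (\<forall>t\<ge>1. b t - b (t - 1) = (m t - m (t - 1)) * g (running_max m (t - 1))) \<and>
     (\<forall>t. running_max b t - b t = (running_max m t - m t) * g (running_max m t))"

definition adapted :: "(nat \<Rightarrow> 'a measure) \<Rightarrow> (nat \<Rightarrow> 'a \<Rightarrow> real) \<Rightarrow> bool" where
  "adapted F X \<longleftrightarrow> (\<forall>t. X t \<in> borel_measurable (F t))"

definition martingale ::
    "'a measure \<Rightarrow> (nat \<Rightarrow> 'a measure) \<Rightarrow> (nat \<Rightarrow> 'a \<Rightarrow> real) \<Rightarrow> bool" where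
  "martingale P F X \<longleftrightarrow>
     adapted F X \<and> (\<forall>t. integrable P (X t)) \<and>
     (\<forall>s t. s \<le> t \<longrightarrow> (AE \<omega> in P. real_cond_exp P (F s) (X t) \<omega> = X s \<omega>))"

definition supermartingale ::
    "'a measure \<Rightarrow> (nat \<Rightarrow> 'a measure) \<Rightarrow> (nat \<Rightarrow> 'a \<Rightarrow> real) \<Rightarrow> bool" where
  "supermartingale P F X \<longleftrightarrow>
     adapted F X \<and> (\<forall>t. integrable P (X t)) \<and>
     (\<forall>s t. s \<le> t \<longrightarrow> (AE \<omega> in P. real_cond_exp P (F s) (X t) \<omega> \<le> X s \<omega>))"

definition stopped :: "(nat \<Rightarrow> 'a \<Rightarrow> real) \<Rightarrow> ('a \<Rightarrow> nat) \<Rightarrow> nat \<Rightarrow> 'a \<Rightarrow> real" where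
  "stopped X T t \<omega> = X (min t (T \<omega>)) \<omega>"

text \<open>
  Stopping times are finite-valued here. This is no restriction for localizing sequences,
  since an extended-valued \<open>T n\<close> can be replaced by its minimum with \<open>n\<close>.

  The local notions are needed because \<open>1 / g (running_max m (t - 1))\<close> may be unbounded, so that
  integrability does not pass from \<open>b\<close> to \<open>m\<close> in general. For example, with \<open>g x = 1 / (1 + x)\<close>
  let \<open>b 1 = b 0 + X\<close> and \<open>b 2 = b 1 + \<epsilon> * X\<close> for a centred integrable \<open>X \<ge> -1\<close> with infinite
  second moment and an independent fair sign \<open>\<epsilon>\<close>: then \<open>m 2\<close> is not integrable.
\<close>

definition localizing_sequence ::
    "'a measure \<Rightarrow> (nat \<Rightarrow> 'a measure) \<Rightarrow> (nat \<Rightarrow> 'a \<Rightarrow> nat) \<Rightarrow> bool" where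
  "localizing_sequence P F T \<longleftrightarrow>
     (\<forall>n. stopping_time F (T n)) \<and>
     (AE \<omega> in P. incseq (\<lambda>n. T n \<omega>) \<and> filterlim (\<lambda>n. T n \<omega>) at_top sequentially)"

definition local_martingale ::
    "'a measure \<Rightarrow> (nat \<Rightarrow> 'a measure) \<Rightarrow> (nat \<Rightarrow> 'a \<Rightarrow> real) \<Rightarrow> bool" where
  "local_martingale P F X \<longleftrightarrow>
     adapted F X \<and> (\<exists>T. localizing_sequence P F T \<and> (\<forall>n. martingale P F (stopped X (T n))))"

definition local_supermartingale ::
    "'a measure \<Rightarrow> (nat \<Rightarrow> 'a measure) \<Rightarrow> (nat \<Rightarrow> 'a \<Rightarrow> real) \<Rightarrow> bool" where
  "local_supermartingale P F X \<longleftrightarrow>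
     adapted F X \<and> (\<exists>T. localizing_sequence P F T \<and> (\<forall>n. supermartingale P F (stopped X (T n))))"

end

theory Submission
  imports Defs
begin

text \<open>
  Concavity and strict monotonicity make \<open>G'\<close> positive and decreasing on \<open>[1, \<infinity>)\<close>. Hence the
  drawdown of \<open>B\<close> is a positive multiple of that of \<open>M\<close>, so both paths reach new maxima at the same
  times. Moreover \<open>M\<close> is the discrete stochastic integral of the nonnegative predictable process
  \<open>1 / G' (S (t - 1))\<close> against \<open>B\<close>. Stopping before the integrand becomes large gives the local
  (super)martingale property. If the negative parts of \<open>M\<close> are integrable, then \<open>M\<close> itself is:
  on the events where the integrand is at most \<open>n\<close>, the expected increment of \<open>M\<close> is at most \<open>0\<close>,
  so its positive part is controlled by its negative part, and \<open>n\<close> tends to infinity.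
\<close>

section \<open>Paths\<close>

lemma running_max_0 [simp]: "running_max x 0 = x 0"
  by (simp add: running_max_def)

lemma running_max_Suc: "running_max x (Suc t) = max (running_max x t) (x (Suc t))"
  by (simp add: running_max_def atMost_Suc max.commute)

lemma running_max_ge_0: "x 0 \<le> running_max x t"
  by (simp add: running_max_def)

lemma ay_path_0 [simp]: "ay_path g b 0 = 1"
  by (simp add: ay_path.simps)

lemma ay_path_Suc:
  "ay_path g b (Suc t) =
    ay_path g b t + (b (Suc t) - b t) / g (running_max (ay_path g b) t)"
  by (subst (1 2) ay_path.simps) simp

text \<open>Induction on the drawdown relation. Before the maxima are updated, positivity of
  \<open>g\<close> gives both drawdowns the same sign. Without a new maximum of \<open>?m\<close>
  the relation carries over with the same factor; at a new maximum both sides vanish, so the factor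
  may change to \<open>g\<close> at the new maximum.\<close>

lemma ay_relations_ay_path:
  assumes g: "\<And>x. 1 \<le> x \<Longrightarrow> 0 < g x"
  shows "ay_relations g b (ay_path g b)"
proof -
  let ?m = "ay_path g b"
  have pos: "0 < g (running_max ?m t)" for t
    using running_max_ge_0[of ?m t] by (intro g) simp
  have inc: "b (Suc t) - b t = (?m (Suc t) - ?m t) * g (running_max ?m t)" for t
    using pos[of t] by (simp add: ay_path_Suc)
  have "running_max b t - b t = (running_max ?m t - ?m t) * g (running_max ?m t)" for t
  proof (induction t)
    case (Suc t)
    let ?S = "running_max ?m t"
    \<comment> \<open>Subtract the increment relation from the induction hypothesis; both carry the
      factor \<open>g ?S\<close> at the old maximum.\<close>
    have eq: "running_max b t - b (Suc t) = (?S - ?m (Suc t)) * g ?S"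
      using Suc inc[of t] by (simp add: algebra_simps)
    show ?case
    proof (cases "?m (Suc t) \<le> ?S")
      case True
      then have "0 \<le> running_max b t - b (Suc t)"
        unfolding eq using pos[of t] by simp
      then have "running_max b (Suc t) = running_max b t"
        by (simp add: running_max_Suc)
      with True eq show ?thesis
        by (simp add: running_max_Suc)
    next
      case False
      then have "running_max b t - b (Suc t) < 0"
        unfolding eq using pos[of t] by (simp add: mult_neg_pos)
      with False show ?thesis
        by (simp add: running_max_Suc max_def)
    qed
  qed simp
  then show ?thesis
    unfolding ay_relations_def using inc by (auto simp: le_Suc_eq dest!: Suc_le_D)
qed

text \<open>Since \<open>g\<close> is positive at the running maximum, the increment relation can be
  solved for the next value. Strong induction is used because that maximum looks at all earlier
  times.\<close>

lemma ay_relations_unique: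
  assumes g: "\<And>x. 1 \<le> x \<Longrightarrow> 0 < g x" and n: "ay_relations g b n"
  shows "n t = ay_path g b t"
proof (induction t rule: less_induct)
  case (less t)
  show ?case
  proof (cases t)
    case 0
    then show ?thesis
      using n by (simp add: ay_relations_def)
  next
    case (Suc u)
    have *: "running_max n u = running_max (ay_path g b) u"
      using less Suc by (intro running_max_cong) auto
    have "0 < g (running_max n u)"
      unfolding * using running_max_ge_0[of "ay_path g b" u] by (intro g) simp
    moreover have "b (Suc u) - b u = (n (Suc u) - n u) * g (running_max n u)"
      using n unfolding ay_relations_def by (metis diff_Suc_1 le_add1 plus_1_eq_Suc)
    moreover have "n u = ay_path g b u"
      using less Suc by simp
    ultimately show ?thesis
      by (simp add: Suc ay_path_Suc flip: *)
  qed
qed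

section \<open>The constructed process and stopped processes as discrete integrals\<close>

lemma ay_process_0 [simp]: "ay_process g B 0 \<omega> = 1"
  by (simp add: ay_process_def)

text \<open>The factor is written in front of the increment of \<open>B\<close> to match the shape
  \<open>K t * (X (Suc t) - X t)\<close> of the transforms below.\<close>

lemma ay_process_Suc:
  "ay_process g B (Suc t) \<omega> = ay_process g B t \<omega>
    + inverse (g (running_max (\<lambda>r. ay_process g B r \<omega>) t)) * (B (Suc t) \<omega> - B t \<omega>)"
  by (simp add: ay_process_def ay_path_Suc divide_inverse_commute)

text \<open>Stopping is itself a transform, with the indicator of \<open>t < T \<omega>\<close> as
  integrand.\<close>

lemma stopped_Suc:
  "stopped X T (Suc t) \<omega> =
    stopped X T t \<omega> + of_bool (t < T \<omega>) * (X (Suc t) \<omega> - X t \<omega>)"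
  by (cases "t < T \<omega>") (auto simp: stopped_def min_absorb1 min_absorb2)

section \<open>Derivatives of concave functions\<close>

text \<open>The tangent at \<open>x\<close> lies above \<open>G\<close>, so \<open>d\<close> is at
  least \<open>G (x + 1) - G x\<close>, which is positive. The tangent inequality is taken from the
  convex function \<open>- G\<close>.\<close>

lemma concave_strict_mono_deriv_pos:
  fixes G :: "real \<Rightarrow> real"
  assumes "concave_on {0..} G" "strict_mono_on {0..} G" "0 < x"
    and deriv: "(G has_real_derivative d) (at x)"
  shows "0 < d"
proof -
  have "- G (x + 1) - - G x \<ge> - d * (x + 1 - x)"
    using assms(1,3) DERIV_minus[OF deriv]
    by (intro convex_on_imp_above_tangent[of "{0..}"])
       (auto simp: concave_on_def intro: has_field_derivative_at_within)
  moreover have "G x < G (x + 1)"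
    using assms(2,3) by (auto simp: strict_mono_on_def)
  ultimately show ?thesis
    by simp
qed

text \<open>The tangents at both points give
  \<open>e * (y - x) \<le> G y - G x \<le> d * (y - x)\<close>.\<close>

lemma concave_deriv_antimono:
  fixes G :: "real \<Rightarrow> real"
  assumes conc: "concave_on {0..} G" and xy: "0 < x" "x \<le> y"
    and dx: "(G has_real_derivative d) (at x)" and dy: "(G has_real_derivative e) (at y)"
  shows "e \<le> d"
proof (cases "x = y")
  case True
  then show ?thesis
    using dx dy DERIV_unique by blast
next
  case False
  have "- G y - - G x \<ge> - d * (y - x)"
    using conc xy DERIV_minus[OF dx]
    by (intro convex_on_imp_above_tangent[of "{0..}"])
       (auto simp: concave_on_def intro: has_field_derivative_at_within)
  moreover have "- G x - - G y \<ge> - e * (x - y)"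
    using conc xy DERIV_minus[OF dy]
    by (intro convex_on_imp_above_tangent[of "{0..}"])
       (auto simp: concave_on_def intro: has_field_derivative_at_within)
  ultimately have "e * (y - x) \<le> d * (y - x)"
    by (simp add: algebra_simps)
  then show ?thesis
    using xy False by simp
qed

section \<open>Transforms of supermartingales\<close>

text \<open>Meant for unbounded \<open>K\<close>, where integrability of the product is the point at
  issue. The negative part of \<open>K * D\<close> bounds the truncated positive parts uniformly in
  \<open>n\<close>, and monotone convergence removes the truncation.\<close>

lemma (in finite_measure_subalgebra) integrable_mult_cond_exp_nonpos:
  fixes D K :: "'a \<Rightarrow> real"
  assumes D: "integrable M D" and D_le: "AE x in M. real_cond_exp M F D x \<le> 0"
    and K: "K \<in> borel_measurable F" "\<And>x. 0 \<le> K x"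
    and neg: "integrable M (\<lambda>x. max 0 (- (K x * D x)))"
  shows "integrable M (\<lambda>x. K x * D x)"
proof -
  \<comment> \<open>Cutting to zero makes \<open>L n * D\<close> equal either to
    \<open>K * D\<close> or to zero: its negative part is dominated by that of \<open>K * D\<close>,
    and its positive part increases with \<open>n\<close>.\<close>
  define L where "L n x = (if K x \<le> real n then K x else 0)" for n x
  have [measurable]: "D \<in> borel_measurable M" "K \<in> borel_measurable M"
    using D measurable_from_subalg[OF subalg K(1)] by auto
  have [measurable]: "L n \<in> borel_measurable M" for n
    unfolding L_def by measurable
  have L_F: "L n \<in> borel_measurable F" for n
    using K(1) unfolding L_def by measurable
  have L_nonneg: "0 \<le> L n x" and L_le: "L n x \<le> real n" for n x
    using K(2) by (auto simp: L_def)
  have LD: "integrable M (\<lambda>x. L n x * D x)" for n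
  proof (rule Bochner_Integration.integrable_bound)
    show "integrable M (\<lambda>x. real n * D x)"
      using D by simp
    show "AE x in M. norm (L n x * D x) \<le> norm (real n * D x)"
      using L_nonneg L_le by (auto simp: abs_mult intro!: mult_right_mono)
  qed measurable
  have int_le: "(\<integral>x. max 0 (L n x * D x) \<partial>M) \<le> (\<integral>x. max 0 (- (K x * D x)) \<partial>M)" for n
  proof -
    \<comment> \<open>\<open>L n\<close> is \<open>F\<close>-measurable, so \<open>D\<close> may be
      replaced by its conditional expectation under the integral.\<close>
    have "(\<integral>x. L n x * D x \<partial>M) = (\<integral>x. L n x * real_cond_exp M F D x \<partial>M)"
      using LD[of n] L_F[of n] by (simp add: real_cond_exp_intg(2))
    also have "\<dots> \<le> 0"
    proof -
      have "AE x in M. 0 \<le> - (L n x * real_cond_exp M F D x)"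
        using D_le by eventually_elim (simp add: L_nonneg mult_nonneg_nonpos)
      then have "0 \<le> (\<integral>x. - (L n x * real_cond_exp M F D x) \<partial>M)"
        by (rule integral_nonneg_AE)
      then show ?thesis
        by simp
    qed
    finally have "(\<integral>x. L n x * D x \<partial>M) \<le> 0" .
    moreover have "(\<integral>x. max 0 (L n x * D x) \<partial>M)
        = (\<integral>x. L n x * D x + max 0 (- (L n x * D x)) \<partial>M)"
      by (intro Bochner_Integration.integral_cong) auto
    moreover have "\<dots> = (\<integral>x. L n x * D x \<partial>M) + (\<integral>x. max 0 (- (L n x * D x)) \<partial>M)"
      using LD by (intro Bochner_Integration.integral_add) auto
    moreover have "(\<integral>x. max 0 (- (L n x * D x)) \<partial>M) \<le> (\<integral>x. max 0 (- (K x * D x)) \<partial>M)"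
      using LD neg by (intro integral_mono) (auto simp: L_def)
    ultimately show ?thesis
      by linarith
  qed
  \<comment> \<open>For each \<open>x\<close> the truncation is inactive once \<open>n\<close>
    reaches \<open>K x\<close>, so the supremum dominates the positive part of
    \<open>K x * D x\<close>.\<close>
  have "(\<integral>\<^sup>+x. ennreal (max 0 (K x * D x)) \<partial>M)
      \<le> (\<integral>\<^sup>+x. (SUP n. ennreal (max 0 (L n x * D x))) \<partial>M)"
  proof (intro nn_integral_mono)
    fix x
    obtain n where "K x \<le> real n"
      using real_arch_simple by blast
    then show "ennreal (max 0 (K x * D x)) \<le> (SUP n. ennreal (max 0 (L n x * D x)))"
      by (intro SUP_upper2[of n]) (auto simp: L_def)
  qed
  also have "\<dots> = (SUP n. \<integral>\<^sup>+x. ennreal (max 0 (L n x * D x)) \<partial>M)"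
  proof (intro nn_integral_monotone_convergence_SUP)
    show "incseq (\<lambda>n x. ennreal (max 0 (L n x * D x)))"
      using K(2) by (intro incseq_SucI le_funI ennreal_leI) (auto simp: L_def max_def zero_le_mult_iff)
  qed measurable
  also have "\<dots> \<le> ennreal (\<integral>x. max 0 (- (K x * D x)) \<partial>M)"
    using LD int_le
    by (intro SUP_least, subst nn_integral_eq_integral) (auto intro: ennreal_leI)
  finally have "(\<integral>\<^sup>+x. ennreal (max 0 (K x * D x)) \<partial>M) < \<infinity>"
    by (rule order_le_less_trans) simp
  then have "integrable M (\<lambda>x. max 0 (K x * D x))"
    by (intro integrableI_nonneg) auto
  then have "integrable M (\<lambda>x. max 0 (K x * D x) - max 0 (- (K x * D x)))"
    using neg by (rule Bochner_Integration.integrable_diff)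
  moreover have "(\<lambda>x. max 0 (K x * D x) - max 0 (- (K x * D x))) = (\<lambda>x. K x * D x)"
    by (auto simp: max_def)
  ultimately show ?thesis
    by simp
qed

section \<open>Filtered probability spaces and one-step criteria\<close>

locale filtered_prob_space = prob_space P + filtration "space P" F
  for P :: "'a measure" and F :: "nat \<Rightarrow> 'a measure" +
  assumes subalgebra_F: "subalgebra P (F t)"
begin

lemma finite_measure_subalgebra_F: "finite_measure_subalgebra P (F t)"
  by unfold_locales (rule subalgebra_F)

sublocale sub: finite_measure_subalgebra P "F t" for t
  by (rule finite_measure_subalgebra_F)

lemma measurable_F_P: "f \<in> borel_measurable (F t) \<Longrightarrow> f \<in> borel_measurable P"
  for f :: "'a \<Rightarrow> real"
  by (rule measurable_from_subalg[OF subalgebra_F])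

lemma measurable_F_mono:
  "f \<in> measurable (F s) N \<Longrightarrow> s \<le> t \<Longrightarrow> f \<in> measurable (F t) N"
  using sets_F_mono[of s t] by (auto simp: measurable_def space_F)

lemma subalgebra_F_mono: "s \<le> t \<Longrightarrow> subalgebra (F t) (F s)"
  using sets_F_mono[of s t] by (auto simp: subalgebra_def space_F)

text \<open>By the tower property, each one-step increment conditioned on \<open>F s\<close> stays
  nonpositive; induction sums these bounds from \<open>s\<close> to \<open>t\<close>.\<close>

lemma supermartingale_Suc_I:
  assumes X: "adapted F X" "\<And>t. integrable P (X t)"
    and step: "\<And>t. AE \<omega> in P. real_cond_exp P (F t) (\<lambda>\<omega>. X (Suc t) \<omega> - X t \<omega>) \<omega> \<le> 0"
  shows "supermartingale P F X"
  unfolding supermartingale_def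
proof (intro conjI allI impI X)
  fix s t :: nat
  assume "s \<le> t"
  then show "AE \<omega> in P. real_cond_exp P (F s) (X t) \<omega> \<le> X s \<omega>"
  proof (induction rule: dec_induct)
    case base
    have "AE \<omega> in P. real_cond_exp P (F s) (X s) \<omega> = X s \<omega>"
      using X by (intro sub.real_cond_exp_F_meas) (auto simp: adapted_def)
    then show ?case
      by auto
  next
    case (step n)
    let ?D = "\<lambda>\<omega>. X (Suc n) \<omega> - X n \<omega>"
    have D: "integrable P ?D"
      using X(2) by simp
    have "AE \<omega> in P. real_cond_exp P (F s) (real_cond_exp P (F n) ?D) \<omega>
        = real_cond_exp P (F s) ?D \<omega>"
      using step D by (intro sub.real_cond_exp_nested_subalg subalgebra_F subalgebra_F_mono) auto
    moreover have "AE \<omega> in P. real_cond_exp P (F s) (real_cond_exp P (F n) ?D) \<omega> \<le> 0"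
      using sub.real_cond_exp_le_c[OF sub.real_cond_exp_int(1)[OF D] assms(3)[of n]] .
    moreover have "AE \<omega> in P. real_cond_exp P (F s) ?D \<omega>
        = real_cond_exp P (F s) (X (Suc n)) \<omega> - real_cond_exp P (F s) (X n) \<omega>"
      using X(2) by (intro sub.real_cond_exp_diff)
    ultimately show ?case
      using step.IH by eventually_elim linarith
  qed
qed

lemma supermartingale_cond_increment:
  assumes "supermartingale P F X"
  shows "AE \<omega> in P. real_cond_exp P (F t) (\<lambda>\<omega>. X (Suc t) \<omega> - X t \<omega>) \<omega> \<le> 0"
proof -
  have "AE \<omega> in P. real_cond_exp P (F t) (\<lambda>\<omega>. X (Suc t) \<omega> - X t \<omega>) \<omega>
      = real_cond_exp P (F t) (X (Suc t)) \<omega> - real_cond_exp P (F t) (X t) \<omega>"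
    using assms by (intro sub.real_cond_exp_diff) (auto simp: supermartingale_def)
  moreover have "AE \<omega> in P. real_cond_exp P (F t) (X t) \<omega> = X t \<omega>"
    using assms by (intro sub.real_cond_exp_F_meas) (auto simp: supermartingale_def adapted_def)
  moreover have "AE \<omega> in P. real_cond_exp P (F t) (X (Suc t)) \<omega> \<le> X t \<omega>"
    using assms by (auto simp: supermartingale_def)
  ultimately show ?thesis
    by eventually_elim linarith
qed

text \<open>Reduces martingale statements to two applications of their supermartingale
  versions.\<close>

lemma martingale_iff_supermartingale:
  "martingale P F X \<longleftrightarrow>
    supermartingale P F X \<and> supermartingale P F (\<lambda>t \<omega>. - X t \<omega>)"
proof -
  have "(AE \<omega> in P. real_cond_exp P (F s) (X t) \<omega> = X s \<omega>) \<longleftrightarrow>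
      (AE \<omega> in P. real_cond_exp P (F s) (X t) \<omega> \<le> X s \<omega>) \<and>
      (AE \<omega> in P. real_cond_exp P (F s) (\<lambda>\<omega>. - X t \<omega>) \<omega> \<le> - X s \<omega>)"
    if "integrable P (X t)" for s t
  proof -
    have "AE \<omega> in P. real_cond_exp P (F s) (\<lambda>\<omega>. - 1 * X t \<omega>) \<omega> = - 1 * real_cond_exp P (F s) (X t) \<omega>"
      using that by (rule sub.real_cond_exp_cmult)
    then have "(AE \<omega> in P. real_cond_exp P (F s) (\<lambda>\<omega>. - X t \<omega>) \<omega> \<le> - X s \<omega>) \<longleftrightarrow>
        (AE \<omega> in P. X s \<omega> \<le> real_cond_exp P (F s) (X t) \<omega>)"
      by (intro eventually_cong) auto
    then show ?thesis
      by (auto simp: order.eq_iff AE_conj_iff)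
  qed
  moreover have "adapted F X \<Longrightarrow> adapted F (\<lambda>t \<omega>. - X t \<omega>)"
    by (simp add: adapted_def)
  ultimately show ?thesis
    unfolding martingale_def supermartingale_def by auto
qed

section \<open>Adaptedness, integrability and the supermartingale property of transforms\<close>

lemma adapted_transform:
  fixes X Y K :: "nat \<Rightarrow> 'a \<Rightarrow> real"
  assumes "adapted F X" "adapted F K"
    and Y0: "Y 0 \<in> borel_measurable (F 0)"
    and Y: "\<And>t \<omega>. Y (Suc t) \<omega> = Y t \<omega> + K t \<omega> * (X (Suc t) \<omega> - X t \<omega>)"
  shows "adapted F Y"
proof -
  have "Y t \<in> borel_measurable (F t)" for t
  proof (induction t)
    case (Suc t)
    have [measurable]: "X (Suc t) \<in> borel_measurable (F (Suc t))"
      "X t \<in> borel_measurable (F (Suc t))" "K t \<in> borel_measurable (F (Suc t))"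
      "Y t \<in> borel_measurable (F (Suc t))"
      using assms(1,2) Suc by (auto simp: adapted_def intro: measurable_F_mono[of _ t])
    show ?case
      unfolding Y[abs_def] by measurable
  qed (rule Y0)
  then show ?thesis
    by (simp add: adapted_def)
qed

text \<open>The factor \<open>K t\<close> is \<open>F t\<close>-measurable and leaves the
  conditional expectation, and its sign preserves the inequality. Integrability of \<open>Y\<close>
  is assumed here; it is obtained below either from a bounded integrand or from integrable negative
  parts.\<close>

lemma supermartingale_transform:
  assumes X: "supermartingale P F X" and K: "adapted F K" "\<And>t \<omega>. 0 \<le> K t \<omega>"
    and Y0: "Y 0 \<in> borel_measurable (F 0)"
    and Y: "\<And>t \<omega>. Y (Suc t) \<omega> = Y t \<omega> + K t \<omega> * (X (Suc t) \<omega> - X t \<omega>)"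
    and int: "\<And>t. integrable P (Y t)"
  shows "supermartingale P F Y"
proof (rule supermartingale_Suc_I)
  show "adapted F Y"
    using X
    by (intro adapted_transform[where X = X and K = K, OF _ K(1) Y0 Y])
       (simp add: supermartingale_def)
next
  fix t
  let ?D = "\<lambda>\<omega>. X (Suc t) \<omega> - X t \<omega>"
  have eq: "Y (Suc t) \<omega> - Y t \<omega> = K t \<omega> * ?D \<omega>" for \<omega>
    by (simp add: Y)
  have "AE \<omega> in P. real_cond_exp P (F t) (\<lambda>\<omega>. K t \<omega> * ?D \<omega>) \<omega> = K t \<omega> * real_cond_exp P (F t) ?D \<omega>"
  proof (rule sub.real_cond_exp_mult)
    show "K t \<in> borel_measurable (F t)"
      using K by (auto simp: adapted_def)
    show "?D \<in> borel_measurable P"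
      using X by (intro borel_measurable_integrable) (auto simp: supermartingale_def)
    \<comment> \<open>The product is an increment of \<open>Y\<close>, which is how its
      integrability is obtained although \<open>K t\<close> may be unbounded.\<close>
    have "integrable P (\<lambda>\<omega>. Y (Suc t) \<omega> - Y t \<omega>)"
      by (intro Bochner_Integration.integrable_diff int)
    then show "integrable P (\<lambda>\<omega>. K t \<omega> * ?D \<omega>)"
      by (simp add: eq)
  qed
  moreover note supermartingale_cond_increment[OF X, of t]
  ultimately show "AE \<omega> in P. real_cond_exp P (F t) (\<lambda>\<omega>. Y (Suc t) \<omega> - Y t \<omega>) \<omega> \<le> 0"
    unfolding eq by eventually_elim (simp add: K(2) mult_nonneg_nonpos)
qed (rule int)

text \<open>The same nonnegative integrand transforms \<open>X\<close> into \<open>Y\<close> and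
  \<open>- X\<close> into \<open>- Y\<close>.\<close>

lemma martingale_transform:
  assumes X: "martingale P F X" and K: "adapted F K" "\<And>t \<omega>. 0 \<le> K t \<omega>"
    and Y0: "Y 0 \<in> borel_measurable (F 0)"
    and Y: "\<And>t \<omega>. Y (Suc t) \<omega> = Y t \<omega> + K t \<omega> * (X (Suc t) \<omega> - X t \<omega>)"
    and int: "\<And>t. integrable P (Y t)"
  shows "martingale P F Y"
  unfolding martingale_iff_supermartingale
proof
  have X': "supermartingale P F X" "supermartingale P F (\<lambda>t \<omega>. - X t \<omega>)"
    using X by (simp_all add: martingale_iff_supermartingale)
  show "supermartingale P F Y"
    by (rule supermartingale_transform[where X = X and K = K, OF X'(1) K Y0 Y int])
  show "supermartingale P F (\<lambda>t \<omega>. - Y t \<omega>)"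
  proof (rule supermartingale_transform[where K = K, OF X'(2) K])
    show "- Y (Suc t) \<omega> = - Y t \<omega> + K t \<omega> * (- X (Suc t) \<omega> - - X t \<omega>)" for t \<omega>
      unfolding Y by (simp add: algebra_simps)
  qed (simp_all add: Y0 int)
qed

lemma integrable_transform_bounded:
  assumes X: "\<And>t. integrable P (X t)" and K: "adapted F K" "\<And>t \<omega>. \<bar>K t \<omega>\<bar> \<le> C"
    and Y0: "integrable P (Y 0)"
    and Y: "\<And>t \<omega>. Y (Suc t) \<omega> = Y t \<omega> + K t \<omega> * (X (Suc t) \<omega> - X t \<omega>)"
  shows "integrable P (Y t)"
proof (induction t)
  case (Suc t)
  have "K t \<in> borel_measurable P"
    using K(1) by (auto simp: adapted_def intro: measurable_F_P)
  moreover have D: "integrable P (\<lambda>\<omega>. X (Suc t) \<omega> - X t \<omega>)"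
    by (intro Bochner_Integration.integrable_diff X)
  ultimately have "(\<lambda>\<omega>. K t \<omega> * (X (Suc t) \<omega> - X t \<omega>)) \<in> borel_measurable P"
    by (intro borel_measurable_times borel_measurable_integrable[OF D])
  moreover have "norm (K t \<omega> * (X (Suc t) \<omega> - X t \<omega>)) \<le> norm (C * (X (Suc t) \<omega> - X t \<omega>))" for \<omega>
    unfolding norm_mult
    using order_trans[OF K(2)[of t \<omega>] abs_ge_self] by (intro mult_right_mono) auto
  ultimately have "integrable P (\<lambda>\<omega>. K t \<omega> * (X (Suc t) \<omega> - X t \<omega>))"
    by (intro Bochner_Integration.integrable_bound[OF integrable_mult_right[OF D, of C]] AE_I2)
  then show ?case
    unfolding Y[abs_def] using Suc by (intro Bochner_Integration.integrable_add)
qed (rule Y0)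

text \<open>Induction on \<open>t\<close>: the increment of \<open>Y\<close> has negative part at
  most that of \<open>Y (Suc t)\<close> plus \<open>\<bar>Y t\<bar>\<close>, hence integrable, and
  \<open>integrable_mult_cond_exp_nonpos\<close> then makes the whole increment integrable.\<close>

lemma integrable_transform_neg_part:
  assumes X: "supermartingale P F X" and K: "adapted F K" "\<And>t \<omega>. 0 \<le> K t \<omega>"
    and Y0: "integrable P (Y 0)"
    and Y: "\<And>t \<omega>. Y (Suc t) \<omega> = Y t \<omega> + K t \<omega> * (X (Suc t) \<omega> - X t \<omega>)"
    and neg: "\<And>t. integrable P (\<lambda>\<omega>. max 0 (- Y t \<omega>))"
  shows "integrable P (Y t)"
proof (induction t)
  case (Suc t)
  let ?D = "\<lambda>\<omega>. X (Suc t) \<omega> - X t \<omega>"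
  have D: "integrable P ?D"
    using X by (auto simp: supermartingale_def)
  have K_F: "K t \<in> borel_measurable (F t)"
    using K by (simp add: adapted_def)
  note [measurable] = borel_measurable_integrable[OF D] measurable_F_P[OF K_F]
  have "integrable P (\<lambda>\<omega>. max 0 (- (K t \<omega> * ?D \<omega>)))"
  proof (rule Bochner_Integration.integrable_bound)
    show "integrable P (\<lambda>\<omega>. max 0 (- Y (Suc t) \<omega>) + \<bar>Y t \<omega>\<bar>)"
      using neg[of "Suc t"] Suc by simp
    show "AE \<omega> in P. norm (max 0 (- (K t \<omega> * ?D \<omega>))) \<le> norm (max 0 (- Y (Suc t) \<omega>) + \<bar>Y t \<omega>\<bar>)"
      unfolding Y by (intro AE_I2) (auto simp: max_def abs_if)
  qed measurable
  then have "integrable P (\<lambda>\<omega>. K t \<omega> * ?D \<omega>)"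
    using supermartingale_cond_increment[OF X, of t] K(2) K_F D
    by (intro sub.integrable_mult_cond_exp_nonpos)
  then show ?case
    unfolding Y[abs_def] using Suc by (intro Bochner_Integration.integrable_add)
qed (rule Y0)

section \<open>Localization\<close>

text \<open>The case of a deterministic 0-1 integrand. It makes the constant times \<open>n\<close>
  localize every supermartingale.\<close>

lemma supermartingale_stopped_const:
  assumes "supermartingale P F X"
  shows "supermartingale P F (stopped X (\<lambda>_. n))"
proof (rule supermartingale_transform[where X = X and K = "\<lambda>t \<omega>. of_bool (t < n)", OF assms])
  show "adapted F (\<lambda>t \<omega>. of_bool (t < n))"
    by (simp add: adapted_def)
  show "stopped X (\<lambda>_. n) 0 \<in> borel_measurable (F 0)"
    "\<And>t. integrable P (stopped X (\<lambda>_. n) t)"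
    using assms by (simp_all add: stopped_def[abs_def] supermartingale_def adapted_def)
qed (auto simp: stopped_Suc)

lemma martingale_stopped_const:
  assumes "martingale P F X"
  shows "martingale P F (stopped X (\<lambda>_. n))"
proof -
  have "stopped (\<lambda>t \<omega>. - X t \<omega>) T = (\<lambda>t \<omega>. - stopped X T t \<omega>)" for T
    by (simp add: stopped_def fun_eq_iff)
  then show ?thesis
    using assms supermartingale_stopped_const[of X n]
      supermartingale_stopped_const[of "\<lambda>t \<omega>. - X t \<omega>" n]
    by (simp add: martingale_iff_supermartingale)
qed

lemma localizing_sequence_const: "localizing_sequence P F (\<lambda>n _. n)"
  by (auto simp: localizing_sequence_def stopping_time_const incseq_def filterlim_ident)

lemma supermartingale_imp_local:
  assumes "supermartingale P F X"
  shows "local_supermartingale P F X"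
  unfolding local_supermartingale_def
proof (intro conjI exI allI)
  show "adapted F X"
    using assms by (simp add: supermartingale_def)
qed (rule localizing_sequence_const supermartingale_stopped_const[OF assms])+

lemma martingale_imp_local:
  assumes "martingale P F X"
  shows "local_martingale P F X"
  unfolding local_martingale_def
proof (intro conjI exI allI)
  show "adapted F X"
    using assms by (simp add: martingale_def)
qed (rule localizing_sequence_const martingale_stopped_const[OF assms])+

text \<open>Stopping before the integrand exceeds \<open>n\<close> turns the transform into one with a bounded integrand.\<close>

definition transform_time :: "(nat \<Rightarrow> 'a \<Rightarrow> real) \<Rightarrow> (nat \<Rightarrow> 'a \<Rightarrow> nat) \<Rightarrow> nat \<Rightarrow> 'a \<Rightarrow> nat" where
  "transform_time K T n \<omega> = (LEAST s. n \<le> s \<or> real n < K s \<omega> \<or> T n \<omega> \<le> s)"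

text \<open>The predicate under \<open>LEAST\<close> holds at \<open>s = n\<close>, so the least
  element exists and satisfies it.\<close>

lemma transform_time_le_iff:
  "transform_time K T n \<omega> \<le> t \<longleftrightarrow> (\<exists>s\<le>t. n \<le> s \<or> real n < K s \<omega> \<or> T n \<omega> \<le> s)"
  (is "_ \<longleftrightarrow> (\<exists>s\<le>t. ?Q s)")
proof
  have "?Q (transform_time K T n \<omega>)"
    unfolding transform_time_def by (rule LeastI[of ?Q n]) simp
  then show "transform_time K T n \<omega> \<le> t \<Longrightarrow> \<exists>s\<le>t. ?Q s"
    by blast
  show "\<exists>s\<le>t. ?Q s \<Longrightarrow> transform_time K T n \<omega> \<le> t"
    unfolding transform_time_def using Least_le[of ?Q] order_trans by blast
qed

lemma transform_time_le: "transform_time K T n \<omega> \<le> T n \<omega>"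
  by (auto simp: transform_time_le_iff)

text \<open>\<open>K t\<close> is known at time \<open>t\<close> but multiplies the step from
  \<open>t\<close> to \<open>Suc t\<close>. Stopping at the first \<open>s\<close> with a large
  \<open>K s\<close> therefore removes the step that \<open>K s\<close> would multiply.\<close>

lemma less_transform_timeD: "t < transform_time K T n \<omega> \<Longrightarrow> K t \<omega> \<le> real n"
  using transform_time_le_iff[of K T n \<omega> t] by (auto simp: not_less[symmetric])

text \<open>The event is a finite union over \<open>s \<le> t\<close> of events known at time
  \<open>t\<close>.\<close>

lemma stopping_time_transform_time:
  assumes K: "adapted F K" and T: "stopping_time F (T n)"
  shows "stopping_time F (transform_time K T n)"
proof
  fix t
  have [measurable]: "Measurable.pred (F t) (\<lambda>\<omega>. T n \<omega> \<le> s)" "K s \<in> borel_measurable (F t)"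
    if "s \<le> t" for s
    using stopping_time_le_const[OF T that] K that
    by (auto simp: adapted_def intro: measurable_F_mono)
  have "Measurable.pred (F t) (\<lambda>\<omega>. \<exists>s\<in>{..t}. n \<le> s \<or> real n < K s \<omega> \<or> T n \<omega> \<le> s)"
    by (rule pred_intros_finite) auto
  then show "Measurable.pred (F t) (\<lambda>\<omega>. transform_time K T n \<omega> \<le> t)"
    by (simp add: transform_time_le_iff Bex_def)
qed

lemma localizing_sequence_transform_time:
  assumes K: "adapted F K" and T: "localizing_sequence P F T"
  shows "localizing_sequence P F (transform_time K T)"
  unfolding localizing_sequence_def
proof
  show "\<forall>n. stopping_time F (transform_time K T n)"
    using T by (auto simp: localizing_sequence_def intro: stopping_time_transform_time[OF K])
  have "AE \<omega> in P. incseq (\<lambda>n. T n \<omega>) \<and> filterlim (\<lambda>n. T n \<omega>) at_top sequentially"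
    using T by (simp add: localizing_sequence_def)
  then show "AE \<omega> in P. incseq (\<lambda>n. transform_time K T n \<omega>) \<and>
      filterlim (\<lambda>n. transform_time K T n \<omega>) at_top sequentially"
  proof eventually_elim
    case (elim \<omega>)
    \<comment> \<open>Each of the three stopping criteria for \<open>Suc n\<close> implies the
      corresponding one for \<open>n\<close>.\<close>
    have "transform_time K T n \<omega> \<le> transform_time K T (Suc n) \<omega>" for n
    proof -
      have "T n \<omega> \<le> T (Suc n) \<omega>"
        using elim by (auto simp: incseq_Suc_iff)
      then show ?thesis
        using transform_time_le_iff[of K T "Suc n" \<omega> "transform_time K T (Suc n) \<omega>"]
        unfolding transform_time_le_iff[of K T n] by (fastforce intro: order_trans)
    qed
    \<comment> \<open>Before time \<open>N\<close> only finitely many values \<open>K s\<close>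
      occur, so a large \<open>n\<close> dominates them all; \<open>n\<close> and
      \<open>T n \<omega>\<close> also pass \<open>N\<close> eventually, and then no criterion fires
      before \<open>N\<close>.\<close>
    moreover have "\<forall>\<^sub>F n in sequentially. N \<le> transform_time K T n \<omega>" for N
    proof -
      have "\<forall>\<^sub>F n in sequentially. N \<le> T n \<omega>"
        using elim by (auto simp: filterlim_at_top)
      moreover have "\<forall>\<^sub>F n in sequentially. N \<le> n"
        by (rule eventually_ge_at_top)
      moreover have "\<forall>\<^sub>F n in sequentially. \<forall>s\<in>{..<N}. K s \<omega> \<le> real n"
        using filterlim_real_sequentially
        by (intro eventually_ball_finite) (auto simp: filterlim_at_top)
      ultimately show ?thesis
      proof eventually_elim
        case (elim n)
        show ?case
        proof (rule ccontr)
          assume "\<not> N \<le> transform_time K T n \<omega>"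
          then obtain s where "s < N" "n \<le> s \<or> real n < K s \<omega> \<or> T n \<omega> \<le> s"
            using transform_time_le_iff[of K T n \<omega> "transform_time K T n \<omega>"]
            by (metis not_le order_le_less_trans order_refl)
          then show False
            using elim by (auto simp: not_less[symmetric])
        qed
      qed
    qed
    ultimately show ?case
      by (auto simp: incseq_Suc_iff filterlim_at_top)
  qed
qed

section \<open>Local and global transforms with a constant initial value\<close>

context
  fixes X Y K :: "nat \<Rightarrow> 'a \<Rightarrow> real" and c :: real
  assumes K: "adapted F K" "\<And>t \<omega>. 0 \<le> K t \<omega>"
    and Y0: "\<And>\<omega>. Y 0 \<omega> = c"
    and Y: "\<And>t \<omega>. Y (Suc t) \<omega> = Y t \<omega> + K t \<omega> * (X (Suc t) \<omega> - X t \<omega>)"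
begin

abbreviation (input) stopped_integrand :: "(nat \<Rightarrow> 'a \<Rightarrow> nat) \<Rightarrow> nat \<Rightarrow> nat \<Rightarrow> 'a \<Rightarrow> real" where
  "stopped_integrand T n t \<omega> \<equiv> of_bool (t < transform_time K T n \<omega>) * K t \<omega>"

lemma adapted_stopped_integrand:
  assumes "localizing_sequence P F T"
  shows "adapted F (stopped_integrand T n)"
proof -
  have "stopping_time F (transform_time K T n)"
    using localizing_sequence_transform_time[OF K(1) assms] by (simp add: localizing_sequence_def)
  note [measurable] = stopping_timeD2[OF this]
  have [measurable]: "K t \<in> borel_measurable (F t)" for t
    using K(1) by (simp add: adapted_def)
  show ?thesis
    unfolding adapted_def of_bool_def by measurable
qed

lemma stopped_integrand_bounded: "\<bar>stopped_integrand T n t \<omega>\<bar> \<le> real n"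
  using K(2)[of t \<omega>] less_transform_timeD[of t K T n \<omega>] by (auto simp: of_bool_def)

text \<open>Before \<open>transform_time K T n\<close> the process \<open>stopped X (T n)\<close>
  still moves like \<open>X\<close>, because \<open>transform_time\<close> is at most
  \<open>T n\<close>. So the stopped \<open>Y\<close> is a transform of the stopped \<open>X\<close>
  with integrand bounded by \<open>n\<close>.\<close>

lemma stopped_transform_Suc:
  "stopped Y (transform_time K T n) (Suc t) \<omega> = stopped Y (transform_time K T n) t \<omega>
    + stopped_integrand T n t \<omega> * (stopped X (T n) (Suc t) \<omega> - stopped X (T n) t \<omega>)"
  using transform_time_le[of K T n \<omega>] by (simp add: stopped_Suc Y)

lemma stopped_transform_0: "stopped Y R 0 = (\<lambda>_. c)"
  by (simp add: stopped_def Y0 fun_eq_iff)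

lemma integrable_stopped_transform:
  assumes "localizing_sequence P F T" and "\<And>t. integrable P (stopped X (T n) t)"
  shows "integrable P (stopped Y (transform_time K T n) t)"
proof (rule integrable_transform_bounded[where X = "stopped X (T n)"
      and K = "stopped_integrand T n" and C = "real n"])
  show "integrable P (stopped Y (transform_time K T n) 0)"
    by (simp add: stopped_transform_0)
qed (use assms adapted_stopped_integrand stopped_integrand_bounded stopped_transform_Suc in auto)

lemma local_supermartingale_transform:
  assumes X: "local_supermartingale P F X"
  shows "local_supermartingale P F Y"
proof -
  obtain T where T: "localizing_sequence P F T"
    and XT: "\<And>n. supermartingale P F (stopped X (T n))"
    using X by (auto simp: local_supermartingale_def)
  have "supermartingale P F (stopped Y (transform_time K T n))" for n
  proof (rule supermartingale_transform[where X = "stopped X (T n)" and K = "stopped_integrand T n"])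
    show "integrable P (stopped Y (transform_time K T n) t)" for t
      using XT[of n] T by (intro integrable_stopped_transform) (auto simp: supermartingale_def)
  qed (use XT K(2) adapted_stopped_integrand[OF T] stopped_transform_Suc in
    \<open>auto simp: stopped_transform_0\<close>)
  moreover have "adapted F Y"
    using X
    by (intro adapted_transform[where X = X and K = K, OF _ K(1) _ Y])
       (auto simp: local_supermartingale_def Y0[abs_def])
  ultimately show ?thesis
    using localizing_sequence_transform_time[OF K(1) T] by (auto simp: local_supermartingale_def)
qed

lemma local_martingale_transform:
  assumes X: "local_martingale P F X"
  shows "local_martingale P F Y"
proof -
  obtain T where T: "localizing_sequence P F T"
    and XT: "\<And>n. martingale P F (stopped X (T n))"
    using X by (auto simp: local_martingale_def)
  have "martingale P F (stopped Y (transform_time K T n))" for n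
  proof (rule martingale_transform[where X = "stopped X (T n)" and K = "stopped_integrand T n"])
    show "integrable P (stopped Y (transform_time K T n) t)" for t
      using XT[of n] T by (intro integrable_stopped_transform) (auto simp: martingale_def)
  qed (use XT K(2) adapted_stopped_integrand[OF T] stopped_transform_Suc in
    \<open>auto simp: stopped_transform_0\<close>)
  moreover have "adapted F Y"
    using X
    by (intro adapted_transform[where X = X and K = K, OF _ K(1) _ Y])
       (auto simp: local_martingale_def Y0[abs_def])
  ultimately show ?thesis
    using localizing_sequence_transform_time[OF K(1) T] by (auto simp: local_martingale_def)
qed

lemma supermartingale_transform_neg_part:
  assumes X: "supermartingale P F X" and neg: "\<And>t. integrable P (\<lambda>\<omega>. max 0 (- Y t \<omega>))"
  shows "supermartingale P F Y"
proof (rule supermartingale_transform[where X = X and K = K and Y = Y, OF X K _ Y])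
  show "integrable P (Y t)" for t
    by (rule integrable_transform_neg_part[where X = X and K = K and Y = Y, OF X K _ Y neg]) (simp add: Y0[abs_def])
qed (simp add: Y0[abs_def])

lemma martingale_transform_neg_part:
  assumes X: "martingale P F X" and neg: "\<And>t. integrable P (\<lambda>\<omega>. max 0 (- Y t \<omega>))"
  shows "martingale P F Y"
proof (rule martingale_transform[where X = X and K = K and Y = Y, OF X K _ Y])
  \<comment> \<open>Integrability of \<open>Y\<close> comes from the supermartingale half of the
    martingale property.\<close>
  have "supermartingale P F X"
    using X by (simp add: martingale_iff_supermartingale)
  then show "integrable P (Y t)" for t
    by (rule integrable_transform_neg_part[where X = X and K = K and Y = Y, OF _ K _ Y neg]) (simp add: Y0[abs_def])
qed (simp add: Y0[abs_def])

end

section \<open>Adaptedness of the constructed process and its integrand\<close>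

lemma borel_measurable_running_max:
  assumes "\<And>s. s \<le> t \<Longrightarrow> X s \<in> borel_measurable N"
  shows "(\<lambda>\<omega>. running_max (\<lambda>r. X r \<omega>) t) \<in> borel_measurable N"
  using assms
proof (induction t)
  case (Suc t)
  then show ?case
    unfolding running_max_Suc by (intro borel_measurable_max) auto
qed simp

lemma adapted_ay_process:
  fixes g :: "real \<Rightarrow> real"
  assumes B: "adapted F B"
    and anti: "\<And>x y. 1 \<le> x \<Longrightarrow> x \<le> y \<Longrightarrow> g y \<le> g x"
  shows "adapted F (ay_process g B)"
    and "adapted F (\<lambda>t \<omega>. inverse (g (running_max (\<lambda>r. ay_process g B r \<omega>) t)))" (is "adapted F ?K")
proof -
  let ?M = "ay_process g B"
  \<comment> \<open>Monotonicity of \<open>g\<close> is known only from 1 on. Clamping the argument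
    at 1 gives a monotone, hence Borel, function on the whole line, and running maxima started at 1
    do not see the clamping.\<close>
  have "mono (\<lambda>x. - g (max 1 x))"
    by (intro monoI) (auto intro!: anti)
  then have "(\<lambda>x. - (- g (max 1 x))) \<in> borel_measurable borel"
    by (rule borel_measurable_uminus[OF borel_measurable_mono])
  then have [measurable]: "(\<lambda>x. g (max 1 x)) \<in> borel_measurable borel"
    by simp
  \<comment> \<open>The sigma-algebra \<open>N\<close> is kept general: the induction for
    \<open>?M\<close> needs \<open>?K u\<close> measurable at time \<open>Suc u\<close>, and the
    final claim needs \<open>?K t\<close> measurable at time \<open>t\<close>.\<close>
  have K: "?K t \<in> borel_measurable N" if "\<And>s. s \<le> t \<Longrightarrow> ?M s \<in> borel_measurable N" for t N
  proof -
    note [measurable] = borel_measurable_running_max[OF that]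
    have "?K t = (\<lambda>\<omega>. inverse (g (max 1 (running_max (\<lambda>r. ?M r \<omega>) t))))"
    proof
      fix \<omega>
      show "?K t \<omega> = inverse (g (max 1 (running_max (\<lambda>r. ?M r \<omega>) t)))"
        using running_max_ge_0[of "\<lambda>r. ?M r \<omega>" t] by (simp add: max_absorb2)
    qed
    moreover have "\<dots> \<in> borel_measurable N"
      by measurable
    ultimately show ?thesis
      by simp
  qed
  have M: "?M t \<in> borel_measurable (F t)" for t
  proof (induction t rule: less_induct)
    case (less t)
    show ?case
    proof (cases t)
      case (Suc u)
      have M_F: "?M s \<in> borel_measurable (F t)" if "s \<le> u" for s
        using that Suc by (intro measurable_F_mono[OF less]) auto
      have "B u \<in> borel_measurable (F u)"
        using B by (simp add: adapted_def)
      then have [measurable]: "B u \<in> borel_measurable (F t)"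
        by (rule measurable_F_mono) (simp add: Suc)
      have [measurable]: "B t \<in> borel_measurable (F t)"
        using B by (simp add: adapted_def)
      have [measurable]: "?M u \<in> borel_measurable (F t)" "?K u \<in> borel_measurable (F t)"
        by (rule M_F[OF order_refl], rule K[OF M_F])
      have "?M t = (\<lambda>\<omega>. ?M u \<omega> + ?K u \<omega> * (B t \<omega> - B u \<omega>))"
        by (simp add: Suc ay_process_Suc fun_eq_iff)
      moreover have "\<dots> \<in> borel_measurable (F t)"
        by measurable
      ultimately show ?thesis
        by simp
    qed (simp add: ay_process_0[abs_def])
  qed
  then show "adapted F ?M"
    by (simp add: adapted_def)
  show "adapted F ?K"
    unfolding adapted_def
  proof
    show "?K t \<in> borel_measurable (F t)" for t
      by (rule K) (rule measurable_F_mono[OF M])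
  qed
qed

end

text \<open>The relations hold at every \<open>\<omega>\<close>; the null set in the uniqueness
  claim comes from the competitor \<open>N\<close>. Since the transform can destroy integrability,
  preservation is stated for the local notions, and for the true ones when the negative parts are
  integrable.\<close>

theorem theorem12:
  fixes P :: "'a measure" and F :: "nat \<Rightarrow> 'a measure"
    and G G' :: "real \<Rightarrow> real" and B :: "nat \<Rightarrow> 'a \<Rightarrow> real"
  assumes "prob_space P"
    and "filtration (space P) F"
    and "\<forall>t. subalgebra P (F t)"
    and "continuous_on {0..} G"
    and "concave_on {0..} G"
    and "strict_mono_on {0..} G"
    and "\<forall>x\<ge>0. 0 \<le> G x"
    and "\<forall>x\<ge>1. (G has_real_derivative G' x) (at x)"
    and "adapted F B"
    and "AE \<omega> in P. B 0 \<omega> = G 1"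
  shows "adapted F (ay_process G' B) \<and>
    (\<forall>\<omega>. ay_relations G' (\<lambda>t. B t \<omega>) (\<lambda>t. ay_process G' B t \<omega>)) \<and>
    (\<forall>N. adapted F N \<and> (AE \<omega> in P. ay_relations G' (\<lambda>t. B t \<omega>) (\<lambda>t. N t \<omega>)) \<longrightarrow>
         (AE \<omega> in P. \<forall>t. N t \<omega> = ay_process G' B t \<omega>)) \<and>
    (supermartingale P F B \<longrightarrow>
       local_supermartingale P F (ay_process G' B) \<and>
       ((\<forall>t. integrable P (\<lambda>\<omega>. max 0 (- ay_process G' B t \<omega>))) \<longrightarrow>
          supermartingale P F (ay_process G' B))) \<and>
    (martingale P F B \<longrightarrow>
       local_martingale P F (ay_process G' B) \<and>
       ((\<forall>t. integrable P (\<lambda>\<omega>. max 0 (- ay_process G' B t \<omega>))) \<longrightarrow>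
          martingale P F (ay_process G' B))) \<and>
    (local_supermartingale P F B \<longrightarrow> local_supermartingale P F (ay_process G' B)) \<and>
    (local_martingale P F B \<longrightarrow> local_martingale P F (ay_process G' B))"
proof -
  have dpos: "0 < G' x" if "1 \<le> x" for x
    by (rule concave_strict_mono_deriv_pos[OF assms(5,6)]) (use assms(8) that in auto)
  have anti: "G' y \<le> G' x" if "1 \<le> x" "x \<le> y" for x y
    by (rule concave_deriv_antimono[OF assms(5) _ that(2)]) (use assms(8) that in auto)
  interpret filtered_prob_space P F
    using assms(1-3)
    by (simp add: filtered_prob_space_def filtered_prob_space_axioms_def)
  let ?M = "ay_process G' B"
  let ?K = "\<lambda>t \<omega>. inverse (G' (running_max (\<lambda>r. ?M r \<omega>) t))"
  have K: "adapted F ?K"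
    using assms(9) anti by (rule adapted_ay_process(2))
  have K_nonneg: "0 \<le> ?K t \<omega>" for t \<omega>
    using running_max_ge_0[of "\<lambda>r. ?M r \<omega>" t] dpos[of "running_max (\<lambda>r. ?M r \<omega>) t"] by simp
  \<comment> \<open>These facts present \<open>?M\<close> as the transform of \<open>B\<close> by
    \<open>?K\<close> with initial value 1.\<close>
  note transform = K K_nonneg ay_process_0[of G' B] ay_process_Suc[of G' B]
  have "local_supermartingale P F ?M" if "local_supermartingale P F B"
    using that by (rule local_supermartingale_transform[where Y = ?M, OF transform])
  moreover have "local_martingale P F ?M" if "local_martingale P F B"
    using that by (rule local_martingale_transform[where Y = ?M, OF transform])
  moreover have "supermartingale P F ?M"
    if "supermartingale P F B" "\<forall>t. integrable P (\<lambda>\<omega>. max 0 (- ?M t \<omega>))"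
    using that(2)
    by (intro supermartingale_transform_neg_part[where Y = ?M, OF transform that(1)]) simp
  moreover have "martingale P F ?M"
    if "martingale P F B" "\<forall>t. integrable P (\<lambda>\<omega>. max 0 (- ?M t \<omega>))"
    using that(2)
    by (intro martingale_transform_neg_part[where Y = ?M, OF transform that(1)]) simp
  moreover have "adapted F ?M"
    using assms(9) anti by (rule adapted_ay_process(1))
  moreover have "ay_relations G' (\<lambda>t. B t \<omega>) (\<lambda>t. ?M t \<omega>)" for \<omega>
    unfolding ay_process_def using ay_relations_ay_path[OF dpos] by simp
  moreover have "AE \<omega> in P. \<forall>t. N t \<omega> = ?M t \<omega>"
    if "AE \<omega> in P. ay_relations G' (\<lambda>t. B t \<omega>) (\<lambda>t. N t \<omega>)" for N
    using that
  proof eventually_elim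
    case (elim \<omega>)
    show ?case
      using ay_relations_unique[OF dpos elim] by (simp add: ay_process_def)
  qed
  ultimately show ?thesis
    \<comment> \<open>True (super)martingales reach the local conclusions by being local
      ones.\<close>
    using supermartingale_imp_local[of B] martingale_imp_local[of B] by simp
qed

end
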